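(* Let $N\ge100$, $\varepsilon\in(0,1/2]$, $p\in[0,1]$, and let $T$ be any quantum channel on $\mathcal{B}(\mathbb{C}^N)$; the quantum register $\mathbb{C}^N$ is subject to the noise $D_p(\varrho)=(1-p)\varrho+pT(\varrho)$, applied once between any two consecutive oracle invocations. The oracle for marked element $x$ is $O_x|y\rangle=(-1)^{\delta_{xy}}|y\rangle$. Consider the following algorithm with $c=10$, $\alpha_g(\varepsilon):=\big(1+\frac{g}{c\log(1/\varepsilon)}\big)^{-1/2}$ and $S_0:=\{1,\ldots,N\}$, repeated for rounds $g=0,1,2,\ldots$: (1) prepare the equal superposition $|\psi_g\rangle=|S_g|^{-1/2}\sum_{y\in S_g}|y\rangle$; (2) perform $k_g$ Grover iterations, each consisting of $O_x$ followed by $I-2|\psi_g\rangle\langle\psi_g|$ (with noise $D_p$ after each iteration), where $k_g:=\lfloor\alpha_g(\varepsilon)\frac\pi4\sqrt{N-g}\rfloor$ if $k_0+\cdots+k_{g-1}+g\le(1-\varepsilon)N$, and $k_g:=0$ otherwise; (3) measure in the standard basis, obtaining $r_g$, and verify $r_g$ with one (noiseless) oracle query, storing it in a noiseless classical output register if $r_g=x$; (4) set $S_{g+1}:=S_g\setminus\{r_g\}$ (recorded in a noiseless classical memory). Each round uses $k_g+1$ oracle queries. Then, for the marked element $x$ chosen uniformly at random, the probability that the marked element has not been found within the first $$\min\left\{100\left(Np+\sqrt N\right)\log\frac1\varepsilon,\;2(1-\varepsilon)N+\sqrt N\right\}$$ oracle queries is at most $\varepsilon$.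
   Context: $\log$ is the natural logarithm. The algorithm does not depend on (or know) $p$ or $T$. *)

theory Defs
  imports Complex_Main
begin

(* N x N complex matrices are represented as functions nat => nat => complex;
  only the entries with indices below N are meaningful. Basis states are
  indexed by 0..N-1 (instead of 1..N). *)

type_synonym cmat = "nat \<Rightarrow> nat \<Rightarrow> complex"

definition mmul :: "nat \<Rightarrow> cmat \<Rightarrow> cmat \<Rightarrow> cmat" where
  "mmul N A B = (\<lambda>i j. \<Sum>k<N. A i k * B k j)"

definition adj :: "cmat \<Rightarrow> cmat" where
  "adj A = (\<lambda>i j. cnj (A j i))"

definition mtrace :: "nat \<Rightarrow> cmat \<Rightarrow> complex" where
  "mtrace N A = (\<Sum>i<N. A i i)"

definition eq_on :: "nat \<Rightarrow> cmat \<Rightarrow> cmat \<Rightarrow> bool" where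
  "eq_on N A B \<longleftrightarrow> (\<forall>i<N. \<forall>j<N. A i j = B i j)"

definition psd :: "nat \<Rightarrow> cmat \<Rightarrow> bool" where
  "psd n A \<longleftrightarrow> (\<forall>i<n. \<forall>j<n. A i j = cnj (A j i)) \<and>
     (\<forall>v :: nat \<Rightarrow> complex. 0 \<le> Re (\<Sum>i<n. \<Sum>j<n. cnj (v i) * A i j * v j))"

definition blk :: "nat \<Rightarrow> (nat \<Rightarrow> nat \<Rightarrow> cmat) \<Rightarrow> cmat" where
  "blk N A = (\<lambda>i j. A (i div N) (j div N) (i mod N) (j mod N))"

definition quantum_channel :: "nat \<Rightarrow> (cmat \<Rightarrow> cmat) \<Rightarrow> bool" where
  "quantum_channel N T \<longleftrightarrow>
     (\<forall>A B. eq_on N A B \<longrightarrow> eq_on N (T A) (T B)) \<and>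
     (\<forall>A B a b. eq_on N (T (\<lambda>i j. a * A i j + b * B i j))
                         (\<lambda>i j. a * T A i j + b * T B i j)) \<and>
     (\<forall>A. mtrace N (T A) = mtrace N A) \<and>
     (\<forall>n A. psd (n * N) (blk N A) \<longrightarrow> psd (n * N) (blk N (\<lambda>a b. T (A a b))))"

definition noise :: "real \<Rightarrow> (cmat \<Rightarrow> cmat) \<Rightarrow> cmat \<Rightarrow> cmat" where
  "noise p T \<rho> = (\<lambda>i j. complex_of_real (1 - p) * \<rho> i j + complex_of_real p * T \<rho> i j)"

definition psi :: "nat set \<Rightarrow> nat \<Rightarrow> complex" where
  "psi S = (\<lambda>i. if i \<in> S then complex_of_real (1 / sqrt (real (card S))) else 0)"

definition orc :: "nat \<Rightarrow> cmat" where
  "orc x = (\<lambda>i j. if i = j then (if i = x then -1 else 1) else 0)"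

definition refl :: "nat set \<Rightarrow> cmat" where
  "refl S = (\<lambda>i j. (if i = j then 1 else 0) - 2 * psi S i * cnj (psi S j))"

definition grover_step :: "nat \<Rightarrow> real \<Rightarrow> (cmat \<Rightarrow> cmat) \<Rightarrow> nat \<Rightarrow> nat set \<Rightarrow> cmat \<Rightarrow> cmat" where
  "grover_step N p T x S \<rho> =
     (let U = mmul N (refl S) (orc x) in noise p T (mmul N (mmul N U \<rho>) (adj U)))"

definition round_state :: "nat \<Rightarrow> real \<Rightarrow> (cmat \<Rightarrow> cmat) \<Rightarrow> nat \<Rightarrow> nat set \<Rightarrow> nat \<Rightarrow> cmat" where
  "round_state N p T x S k = (grover_step N p T x S ^^ k) (\<lambda>i j. psi S i * cnj (psi S j))"

definition alpha :: "real \<Rightarrow> nat \<Rightarrow> real" where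
  "alpha \<epsilon> g = (1 + real g / (10 * ln (1 / \<epsilon>))) powr (-1/2)"

(* k_g; q = k_0 + ... + k_{g-1} + g is the number of queries used before round g. *)
definition kg :: "nat \<Rightarrow> real \<Rightarrow> nat \<Rightarrow> nat \<Rightarrow> nat" where
  "kg N \<epsilon> g q = (if real q \<le> (1 - \<epsilon>) * real N
      then nat \<lfloor>alpha \<epsilon> g * (pi / 4) * sqrt (real N - real g)\<rfloor> else 0)"

(* notfound N eps p T x Q f g S q: probability that x is not found by any verification
  query with index at most Q, from round g on, given current set S and q queries used so far;
  f is a fuel parameter (each round uses at least one query, so fuel nat floor Q + 1 suffices). *)
fun notfound :: "nat \<Rightarrow> real \<Rightarrow> real \<Rightarrow> (cmat \<Rightarrow> cmat) \<Rightarrow> nat \<Rightarrow> real \<Rightarrow>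
                 nat \<Rightarrow> nat \<Rightarrow> nat set \<Rightarrow> nat \<Rightarrow> real" where
  "notfound N \<epsilon> p T x Q 0 g S q = 1"
| "notfound N \<epsilon> p T x Q (Suc f) g S q =
     (let k = kg N \<epsilon> g q in
      if real (q + k + 1) > Q then 1
      else (let \<rho> = round_state N p T x S k in
            (\<Sum>r<N. if r = x then 0
                    else Re (\<rho> r r) * notfound N \<epsilon> p T x Q f (Suc g) (S - {r}) (q + k + 1))))"

end

(* A round that starts from the superposition over S survives k noisy iterations without any
  noise event with probability (1 - p)^k, and positivity of the channel makes its success
  probability at least (1 - p)^k sin^2((2k + 1) theta) with sin theta = |S|^(-1/2), whatever
  the noise does otherwise.

  Put L = ln (1/eps), D = 1 + p sqrt N and A = 49 L D sqrt N, and consider the rounds g for which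
  v = (1 + g / (10 L))^(1/2) lies in [u/2, u], where u = 5D/2. There are about 7.5 L u^2 of them.
  In each, k is of order sqrt N / v, hence p k is bounded and the success probability is at least
  0.29 / u^2; so they all fail with probability at most exp (-L) = eps. If A is at most
  (1 - eps) N, they are over within A queries. Otherwise the budget is 2 (1 - eps) N + sqrt N,
  which leaves at least (1 - eps) N rounds of classical search without replacement after the last quantum
  round, and these miss x with probability at most eps. *)

theory Submission
  imports Defs "HOL-Analysis.Analysis"
begin

section \<open>Positive semidefinite matrices\<close>

lemma psdI:
  assumes "\<And>i j. i < n \<Longrightarrow> j < n \<Longrightarrow> cnj (A j i) = A i j"
    and "\<And>v. 0 \<le> Re (\<Sum>i<n. \<Sum>j<n. cnj (v i) * A i j * v j)"
  shows "psd n A"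
  unfolding psd_def using assms by metis

lemma psd_hermitian: "psd n A \<Longrightarrow> i < n \<Longrightarrow> j < n \<Longrightarrow> cnj (A j i) = A i j"
  unfolding psd_def by metis

lemma psd_form: "psd n A \<Longrightarrow> 0 \<le> Re (\<Sum>i<n. \<Sum>j<n. cnj (v i) * A i j * v j)"
  unfolding psd_def by blast

lemma psd_add:
  assumes "psd n A" "psd n B" shows "psd n (\<lambda>i j. A i j + B i j)"
proof (rule psdI)
  fix v :: "nat \<Rightarrow> complex"
  have "(\<Sum>i<n. \<Sum>j<n. cnj (v i) * (A i j + B i j) * v j)
      = (\<Sum>i<n. \<Sum>j<n. cnj (v i) * A i j * v j) + (\<Sum>i<n. \<Sum>j<n. cnj (v i) * B i j * v j)"
    by (simp add: distrib_left distrib_right sum.distrib)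
  with psd_form[OF assms(1), of v] psd_form[OF assms(2), of v]
  show "0 \<le> Re (\<Sum>i<n. \<Sum>j<n. cnj (v i) * (A i j + B i j) * v j)" by simp
qed (simp add: psd_hermitian[OF assms(1)] psd_hermitian[OF assms(2)])

lemma psd_scale:
  assumes "0 \<le> c" "psd n A" shows "psd n (\<lambda>i j. complex_of_real c * A i j)"
proof (rule psdI)
  fix v :: "nat \<Rightarrow> complex"
  have "(\<Sum>i<n. \<Sum>j<n. cnj (v i) * (complex_of_real c * A i j) * v j)
      = complex_of_real c * (\<Sum>i<n. \<Sum>j<n. cnj (v i) * A i j * v j)"
    by (simp add: sum_distrib_left mult_ac)
  then show "0 \<le> Re (\<Sum>i<n. \<Sum>j<n. cnj (v i) * (complex_of_real c * A i j) * v j)"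
    using assms(1) psd_form[OF assms(2), of v] by simp
qed (simp add: psd_hermitian[OF assms(2)])

lemma psd_diag:
  assumes "psd n A" "r < n" shows "0 \<le> Re (A r r)"
proof -
  have "(\<Sum>i<n. \<Sum>j<n. cnj (if i = r then 1 else 0) * A i j * (if j = r then 1 else 0)) = A r r"
    using assms(2) by (simp add: if_distrib[of cnj] if_distrib[of "\<lambda>z. _ * z"] if_distrib[of "\<lambda>z. z * _"] cong: if_cong)
  moreover note psd_form[OF assms(1), of "\<lambda>i. if i = r then 1 else 0"]
  ultimately show ?thesis by simp
qed

lemma psd_zero: "psd n (\<lambda>i j. 0)"
  by (simp add: psd_def)

lemma psd_conjugate:
  assumes "psd n A" shows "psd n (mmul n (mmul n U A) (adj U))"
proof (rule psdI)
  fix i j assume "i < n" "j < n"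
  have "cnj (mmul n (mmul n U A) (adj U) j i) = (\<Sum>k<n. \<Sum>l<n. U i k * cnj (A l k) * cnj (U j l))"
    by (simp add: mmul_def adj_def sum_distrib_right sum_distrib_left mult.commute mult.left_commute)
  also have "\<dots> = (\<Sum>k<n. \<Sum>l<n. U i k * A k l * cnj (U j l))"
    by (intro sum.cong refl) (simp add: psd_hermitian[OF assms])
  also have "\<dots> = mmul n (mmul n U A) (adj U) i j"
    unfolding mmul_def adj_def sum_distrib_right by (rule sum.swap)
  finally show "cnj (mmul n (mmul n U A) (adj U) j i) = mmul n (mmul n U A) (adj U) i j" .
next
  fix v :: "nat \<Rightarrow> complex"
  \<comment> \<open>With \<open>w\<close> = \<open>adj U\<close> applied to \<open>v\<close>, the
    form of the conjugated matrix at \<open>v\<close> is the form of \<open>A\<close> at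
    \<open>w\<close>. What follows only brings the four sums into the matching order.\<close>
  define w where "w = (\<lambda>l. \<Sum>j<n. cnj (U j l) * v j)"
  have "(\<Sum>i<n. \<Sum>j<n. cnj (v i) * mmul n (mmul n U A) (adj U) i j * v j)
      = (\<Sum>i<n. \<Sum>j<n. \<Sum>l<n. \<Sum>k<n. cnj (v i) * U i k * A k l * cnj (U j l) * v j)"
    by (simp add: mmul_def adj_def sum_distrib_right sum_distrib_left mult.assoc)
  also have "\<dots> = (\<Sum>i<n. \<Sum>l<n. \<Sum>j<n. \<Sum>k<n. cnj (v i) * U i k * A k l * cnj (U j l) * v j)"
    by (intro sum.cong refl sum.swap)
  also have "\<dots> = (\<Sum>l<n. \<Sum>i<n. \<Sum>j<n. \<Sum>k<n. cnj (v i) * U i k * A k l * cnj (U j l) * v j)"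
    by (rule sum.swap)
  also have "\<dots> = (\<Sum>l<n. \<Sum>i<n. \<Sum>k<n. \<Sum>j<n. cnj (v i) * U i k * A k l * cnj (U j l) * v j)"
    by (intro sum.cong refl sum.swap)
  also have "\<dots> = (\<Sum>l<n. \<Sum>k<n. \<Sum>i<n. \<Sum>j<n. cnj (v i) * U i k * A k l * cnj (U j l) * v j)"
    by (intro sum.cong refl sum.swap)
  also have "\<dots> = (\<Sum>k<n. \<Sum>l<n. \<Sum>i<n. \<Sum>j<n. cnj (v i) * U i k * A k l * cnj (U j l) * v j)"
    by (rule sum.swap)
  also have "\<dots> = (\<Sum>k<n. \<Sum>l<n. cnj (w k) * A k l * w l)"
    unfolding w_def cnj_sum
    by (intro sum.cong refl) (simp add: sum_product sum_distrib_right sum_distrib_left mult_ac)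
  finally have eq: "(\<Sum>i<n. \<Sum>j<n. cnj (v i) * mmul n (mmul n U A) (adj U) i j * v j)
      = (\<Sum>k<n. \<Sum>l<n. cnj (w k) * A k l * w l)" .
  show "0 \<le> Re (\<Sum>i<n. \<Sum>j<n. cnj (v i) * mmul n (mmul n U A) (adj U) i j * v j)"
    unfolding eq by (rule psd_form[OF assms])
qed

lemma psd_outer: "psd n (\<lambda>i j. v i * cnj (v j))"
proof (rule psdI)
  fix u :: "nat \<Rightarrow> complex"
  define z where "z = (\<Sum>i<n. cnj (u i) * v i)"
  have "(\<Sum>i<n. \<Sum>j<n. cnj (u i) * (v i * cnj (v j)) * u j)
      = (\<Sum>i<n. cnj (u i) * v i) * (\<Sum>j<n. cnj (v j) * u j)"
    unfolding sum_product by (simp add: mult_ac)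
  also have "\<dots> = z * cnj z"
    by (simp add: z_def mult.commute)
  finally show "0 \<le> Re (\<Sum>i<n. \<Sum>j<n. cnj (u i) * (v i * cnj (v j)) * u j)"
    by (simp only: complex_mult_cnj Re_complex_of_real) simp
qed simp

lemma psd_cong:
  assumes "\<And>i j. i < n \<Longrightarrow> j < n \<Longrightarrow> A i j = B i j"
  shows "psd n A \<longleftrightarrow> psd n B"
proof -
  have "(\<Sum>i<n. \<Sum>j<n. cnj (v i) * A i j * v j) = (\<Sum>i<n. \<Sum>j<n. cnj (v i) * B i j * v j)" for v
    using assms by simp
  moreover have "(\<forall>i<n. \<forall>j<n. A i j = cnj (A j i)) \<longleftrightarrow> (\<forall>i<n. \<forall>j<n. B i j = cnj (B j i))"
    using assms by metis
  ultimately show ?thesis unfolding psd_def by metis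
qed

text \<open>This is complete positivity with a one-dimensional ancilla: with a single block,
  \<open>blk\<close> changes no entry below N.\<close>

lemma psd_channel:
  assumes "quantum_channel N T" "psd N A" shows "psd N (T A)"
proof -
  have blk: "psd (1 * N) (blk N (\<lambda>a b. B)) \<longleftrightarrow> psd N B" for B
  proof -
    have "blk N (\<lambda>a b. B) i j = B i j" if "i < N" "j < N" for i j
      using that by (simp add: blk_def)
    then have "psd N (blk N (\<lambda>a b. B)) \<longleftrightarrow> psd N B"
      by (intro psd_cong) simp
    then show ?thesis by simp
  qed
  have "psd (1 * N) (blk N (\<lambda>a b. A)) \<longrightarrow> psd (1 * N) (blk N (\<lambda>a b. T A))"
    using assms(1) unfolding quantum_channel_def by (elim conjE allE[of _ "1 :: nat"] allE[of _ "\<lambda>a b. A"])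
  then show ?thesis using assms(2) unfolding blk by blast
qed

section \<open>Conjugation, trace and unitarity of a Grover iteration\<close>

definition mvec :: "nat \<Rightarrow> cmat \<Rightarrow> (nat \<Rightarrow> complex) \<Rightarrow> nat \<Rightarrow> complex" where
  "mvec N U v = (\<lambda>i. \<Sum>k<N. U i k * v k)"

text \<open>A rank-one matrix stays rank one under conjugation. The scalar \<open>a\<close> is
  carried along for the weight (1 - p)^k of the noiseless component.\<close>

lemma conjugate_outer:
  "mmul N (mmul N U (\<lambda>i j. a * (v i * cnj (v j)))) (adj U)
    = (\<lambda>i j. a * (mvec N U v i * cnj (mvec N U v j)))"
proof (intro ext)
  fix i j
  have "mmul N (mmul N U (\<lambda>i j. a * (v i * cnj (v j)))) (adj U) i j
     = (\<Sum>l<N. \<Sum>k<N. a * (U i k * v k * cnj (U j l * v l)))"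
    by (simp add: mmul_def adj_def sum_distrib_right sum_distrib_left mult_ac)
  also have "\<dots> = (\<Sum>k<N. \<Sum>l<N. a * (U i k * v k * cnj (U j l * v l)))"
    by (rule sum.swap)
  also have "\<dots> = a * (mvec N U v i * cnj (mvec N U v j))"
    unfolding mvec_def cnj_sum sum_product by (simp add: sum_distrib_left mult_ac)
  finally show "mmul N (mmul N U (\<lambda>i j. a * (v i * cnj (v j)))) (adj U) i j
     = a * (mvec N U v i * cnj (mvec N U v j))" .
qed

lemma conjugate_diff:
  "mmul N (mmul N U (\<lambda>i j. A i j - B i j)) (adj U) = (\<lambda>i j.
    mmul N (mmul N U A) (adj U) i j - mmul N (mmul N U B) (adj U) i j)"
  by (simp add: mmul_def sum_subtractf right_diff_distrib left_diff_distrib)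

text \<open>The hypothesis says entrywise that \<open>adj U\<close> times \<open>U\<close> is the
  identity; moving the sum over the row index i innermost exposes it.\<close>

lemma mtrace_conjugate:
  assumes unit: "\<And>k l. k < N \<Longrightarrow> l < N \<Longrightarrow> (\<Sum>i<N. cnj (U i l) * U i k) = (if k = l then 1 else 0)"
  shows "mtrace N (mmul N (mmul N U A) (adj U)) = mtrace N A"
proof -
  have "mtrace N (mmul N (mmul N U A) (adj U)) = (\<Sum>i<N. \<Sum>l<N. \<Sum>k<N. A k l * (cnj (U i l) * U i k))"
    by (simp add: mtrace_def mmul_def adj_def sum_distrib_right sum_distrib_left mult_ac)
  also have "\<dots> = (\<Sum>l<N. \<Sum>i<N. \<Sum>k<N. A k l * (cnj (U i l) * U i k))"
    by (rule sum.swap)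
  also have "\<dots> = (\<Sum>l<N. \<Sum>k<N. \<Sum>i<N. A k l * (cnj (U i l) * U i k))"
    by (intro sum.cong refl sum.swap)
  also have "\<dots> = (\<Sum>l<N. \<Sum>k<N. A k l * (if k = l then 1 else 0))"
    by (intro sum.cong) (auto simp: sum_distrib_left[symmetric] unit)
  also have "\<dots> = mtrace N A"
    by (simp add: mtrace_def if_distrib[of "\<lambda>z. _ * z"] cong: if_cong)
  finally show ?thesis .
qed

lemma sum_psi:
  assumes "S \<subseteq> {..<N}"
  shows "(\<Sum>i<N. psi S i * f i) = of_real (1 / sqrt (card S)) * (\<Sum>i\<in>S. f i)"
proof -
  have "(\<Sum>i<N. psi S i * f i) = (\<Sum>i\<in>S. psi S i * f i)"
    using assms by (intro sum.mono_neutral_right) (auto simp: psi_def)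
  then show ?thesis by (simp add: psi_def sum_distrib_left)
qed

lemma cnj_psi [simp]: "cnj (psi S i) = psi S i"
  by (simp add: psi_def)

lemma psi_normalized:
  assumes "S \<subseteq> {..<N}" "S \<noteq> {}"
  shows "(\<Sum>i<N. psi S i * psi S i) = 1"
proof -
  have fin: "finite S" using assms(1) finite_subset by blast
  have "(\<Sum>i\<in>S. psi S i) = of_real (card S / sqrt (card S))"
    by (simp add: psi_def)
  with assms fin show ?thesis
    by (simp add: sum_psi flip: of_real_mult)
qed

lemma grover_entry:
  assumes "j < N"
  shows "mmul N (refl S) (orc x) i j = refl S i j * (if j = x then -1 else 1)"
  using assms by (simp add: mmul_def orc_def if_distrib[of "\<lambda>z. _ * z"] cong: if_cong)

text \<open>In the product of two columns, the two cross terms -2 psi_l psi_k cancel against 4 psi_l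
  psi_k, because psi is normalized.\<close>

lemma refl_unitary:
  assumes "S \<subseteq> {..<N}" "S \<noteq> {}" "k < N" "l < N"
  shows "(\<Sum>i<N. refl S i l * refl S i k) = (if k = l then 1 else 0)"
proof -
  have "(\<Sum>i<N. refl S i l * refl S i k) = (\<Sum>i<N. (if i = l then (if i = k then 1 else 0) else 0)
      - (if i = l then 2 * psi S l * psi S k else 0) - (if i = k then 2 * psi S k * psi S l else 0)
      + 4 * psi S l * psi S k * (psi S i * psi S i))"
    by (intro sum.cong) (auto simp: refl_def algebra_simps)
  also have "\<dots> = (if k = l then 1 else 0)"
    using assms by (simp add: sum.distrib sum_subtractf psi_normalized flip: sum_distrib_left)
  finally show ?thesis .
qed

text \<open>The oracle only changes the sign of column x, so the columns stay orthonormal.\<close>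

lemma grover_unitary:
  fixes x :: nat
  assumes "S \<subseteq> {..<N}" "S \<noteq> {}" "k < N" "l < N"
  defines "U \<equiv> mmul N (refl S) (orc x)"
  shows "(\<Sum>i<N. cnj (U i l) * U i k) = (if k = l then 1 else 0)"
proof -
  have "cnj (refl S i l) = refl S i l" for i by (simp add: refl_def)
  then have "(\<Sum>i<N. cnj (U i l) * U i k)
     = (if l = x then -1 else 1) * (if k = x then -1 else 1) * (\<Sum>i<N. refl S i l * refl S i k)"
    unfolding U_def using assms by (simp add: grover_entry sum_distrib_left)
  then show ?thesis using refl_unitary[OF assms(1-4)] by auto
qed

section \<open>Noisy rounds and their noiseless component\<close>

definition grover_vec :: "nat \<Rightarrow> nat \<Rightarrow> nat set \<Rightarrow> nat \<Rightarrow> nat \<Rightarrow> complex" where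
  "grover_vec N x S k = (mvec N (mmul N (refl S) (orc x)) ^^ k) (psi S)"

(* The state stays above its noiseless component in the positive semidefinite order, because
  both the unitary step and the channel preserve positivity. *)
lemma round_state_invariant:
  assumes T: "quantum_channel N T" and p: "0 \<le> p" "p \<le> 1" and S: "S \<subseteq> {..<N}" "S \<noteq> {}"
  shows "psd N (\<lambda>i j. round_state N p T x S k i j
      - complex_of_real ((1 - p) ^ k) * (grover_vec N x S k i * cnj (grover_vec N x S k j)))
    \<and> mtrace N (round_state N p T x S k) = 1"
    (is "psd N (?D k) \<and> _")
proof (induction k)
  case 0
  then show ?case using psi_normalized[OF S]
    by (simp add: round_state_def grover_vec_def psd_zero mtrace_def)
next
  case (Suc k)
  define U where "U = mmul N (refl S) (orc x)"
  define \<rho> where "\<rho> = round_state N p T x S k"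
  define w where "w = grover_vec N x S k"
  define c where "c = complex_of_real ((1 - p) ^ k)"
  define R where "R = mmul N (mmul N U \<rho>) (adj U)"
  have IH: "psd N (\<lambda>i j. \<rho> i j - c * (w i * cnj (w j)))" "mtrace N \<rho> = 1"
    using Suc by (auto simp: \<rho>_def w_def c_def)
  have step: "round_state N p T x S (Suc k) = noise p T R"
    by (simp add: round_state_def \<rho>_def R_def U_def grover_step_def Let_def)
  have w': "grover_vec N x S (Suc k) = mvec N U w"
    by (simp add: grover_vec_def w_def U_def)
  have D: "psd N (\<lambda>i j. R i j - c * (mvec N U w i * cnj (mvec N U w j)))"
    using psd_conjugate[OF IH(1), of U] by (simp add: conjugate_diff conjugate_outer R_def)
  \<comment> \<open>The channel acts on all of \<open>R\<close>, so \<open>R\<close> itself must be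
    positive: add the noiseless component back to the positive difference \<open>D\<close>.\<close>
  have "0 \<le> (1 - p) ^ k" using p by simp
  from psd_add[OF D psd_scale[OF this psd_outer[of N "mvec N U w"]]]
  have R: "psd N R" by (simp add: c_def)
  have trR: "mtrace N R = 1"
    unfolding R_def using mtrace_conjugate[of N U \<rho>] grover_unitary[OF S] IH(2) by (simp add: U_def)
  \<comment> \<open>The noiseless weight picks up exactly one factor 1 - p, so the new difference is
    a nonnegative combination of the conjugated old difference and \<open>T R\<close>.\<close>
  have "?D (Suc k) = (\<lambda>i j. of_real (1 - p) * (R i j - c * (mvec N U w i * cnj (mvec N U w j)))
      + of_real p * T R i j)"
    unfolding step w' by (simp add: noise_def c_def algebra_simps)
  moreover have "psd N \<dots>"
    using p by (intro psd_add psd_scale D psd_channel[OF T R]) auto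
  ultimately have 1: "psd N (?D (Suc k))" by simp
  have "mtrace N (T R) = 1" using T trR unfolding quantum_channel_def by simp
  moreover have "mtrace N (noise p T R) = of_real (1 - p) * mtrace N R + of_real p * mtrace N (T R)"
    by (simp add: mtrace_def noise_def sum.distrib sum_distrib_left)
  ultimately have "mtrace N (noise p T R) = 1" using trR by simp
  with 1 step show ?case by simp
qed

text \<open>Diagonal entries of the positive difference in the invariant are nonnegative.\<close>

lemma round_state_success:
  assumes "quantum_channel N T" "0 \<le> p" "p \<le> 1" "S \<subseteq> {..<N}" "S \<noteq> {}" "r < N"
  shows "(1 - p) ^ k * (cmod (grover_vec N x S k r))\<^sup>2 \<le> Re (round_state N p T x S k r r)"
  using psd_diag[OF conjunct1[OF round_state_invariant[OF assms(1-5), of x k]] assms(6)]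
  by (simp add: complex_norm_square[symmetric] flip: of_real_power of_real_mult)

lemma round_state_nonneg:
  assumes "quantum_channel N T" "0 \<le> p" "p \<le> 1" "S \<subseteq> {..<N}" "S \<noteq> {}" "r < N"
  shows "0 \<le> Re (round_state N p T x S k r r)"
proof -
  have "0 \<le> (1 - p) ^ k * (cmod (grover_vec N x S k r))\<^sup>2" using assms by simp
  also note round_state_success[OF assms]
  finally show ?thesis .
qed

lemma round_state_sum:
  assumes "quantum_channel N T" "0 \<le> p" "p \<le> 1" "S \<subseteq> {..<N}" "S \<noteq> {}"
  shows "(\<Sum>r<N. Re (round_state N p T x S k r r)) = 1"
  using conjunct2[OF round_state_invariant[OF assms, of x k]]
  unfolding mtrace_def by (metis Re_sum one_complex.sel(1))

section \<open>Noiseless Grover amplitudes\<close>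

text \<open>The amplitudes stay real, constant on S - {x} and zero outside S, so the evolution is a
  rotation by 2 theta in a plane. The sign (-1)^k appears because \<open>refl\<close> is the
  negative of the usual diffusion operator 2 psi psi^T - I.\<close>

lemma grover_vec_closed_form:
  assumes S: "S \<subseteq> {..<N}" "x \<in> S" and m: "2 \<le> card S" and i: "i < N"
  defines "\<theta> \<equiv> arcsin (1 / sqrt (card S))"
  shows "grover_vec N x S k i = of_real ((-1) ^ k *
    (if i = x then sin ((2 * k + 1) * \<theta>) else if i \<in> S then cos ((2 * k + 1) * \<theta>) / sqrt (card S - 1) else 0))"
  using i
proof (induction k arbitrary: i)
  have fin: "finite S" using S(1) finite_subset by blast
  define m where "m = real (card S)"
  have m2: "m \<ge> 2" using m by (simp add: m_def)
  have m1: "real (card S - 1) = m - 1" using m by (simp add: m_def of_nat_diff)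
  have th: "\<theta> = arcsin (1 / sqrt m)" by (simp add: \<theta>_def m_def)
  have "1 / sqrt m \<le> 1" using m2 by simp
  moreover have "0 \<le> 1 / sqrt m" using m2 by simp
  then have "-1 \<le> 1 / sqrt m" by linarith
  ultimately have sin: "sin \<theta> = 1 / sqrt m" and cos: "cos \<theta> = sqrt (1 - (1 / sqrt m)\<^sup>2)"
    unfolding th by (simp_all add: cos_arcsin)
  have cos: "cos \<theta> = sqrt (m - 1) / sqrt m"
    unfolding cos using m2 by (simp add: power_divide diff_divide_distrib flip: real_sqrt_divide)
  {
    case 0
    show ?case using 0 m2
      by (auto simp: grover_vec_def psi_def sin cos S m_def[symmetric] m1[unfolded One_nat_def])
  next
    case (Suc k)
    define \<phi> where "\<phi> = (2 * real k + 1) * \<theta>"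
    \<comment> \<open>\<open>a\<close> is the amplitude at x and \<open>b\<close> the common
      amplitude on the rest of S after k iterations.\<close>
    define a where "a = (-1) ^ k * sin \<phi>"
    define b where "b = (-1) ^ k * (cos \<phi> / sqrt (m - 1))"
    define w where "w = grover_vec N x S k"
    have w: "w j = of_real (if j = x then a else if j \<in> S then b else 0)" if "j < N" for j
      using Suc.IH[OF that] by (simp add: w_def a_def b_def \<phi>_def m1[unfolded One_nat_def])
    have ow: "(if j = x then -1 else 1) * w j = of_real (if j = x then -a else if j \<in> S then b else 0)" if "j < N" for j
      using w[OF that] by simp
    have "grover_vec N x S (Suc k) i = mvec N (mmul N (refl S) (orc x)) w i"
      by (simp add: grover_vec_def w_def)
    also have "\<dots> = (\<Sum>j<N. refl S i j * ((if j = x then -1 else 1) * w j))"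
      unfolding mvec_def by (intro sum.cong refl) (simp add: grover_entry mult.assoc)
    also have "\<dots> = (\<Sum>j<N. refl S i j * of_real (if j = x then -a else if j \<in> S then b else 0))"
      using ow by (intro sum.cong refl) simp
    also have "\<dots> = (\<Sum>j<N. (if j = i then of_real (if j = x then -a else if j \<in> S then b else 0) else 0)
         - 2 * psi S i * (psi S j * of_real (if j = x then -a else if j \<in> S then b else 0)))"
      by (intro sum.cong refl) (simp add: refl_def algebra_simps)
    also have "\<dots> = of_real (if i = x then -a else if i \<in> S then b else 0)
         - 2 * psi S i * (\<Sum>j<N. psi S j * of_real (if j = x then -a else if j \<in> S then b else 0))"
      using Suc.prems by (simp add: sum_subtractf sum_distrib_left)
    also have "(\<Sum>j<N. psi S j * of_real (if j = x then -a else if j \<in> S then b else 0))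
        = of_real (1 / sqrt m * (\<Sum>j\<in>S. if j = x then -a else if j \<in> S then b else 0))"
      by (simp add: sum_psi[OF S(1)] m_def)
    also have "(\<Sum>j\<in>S. if j = x then -a else if j \<in> S then b else 0) = - a + (m - 1) * b"
      using S fin m1 by (subst sum.remove[OF fin S(2)]) (simp add: card_Diff_singleton)
    finally have g: "grover_vec N x S (Suc k) i = of_real (if i = x then -a else if i \<in> S then b else 0)
         - 2 * psi S i * of_real (1 / sqrt m * (- a + (m - 1) * b))" .
    have mm: "sqrt m * sqrt m = m" "sqrt (m-1) * sqrt (m-1) = m - 1" "sqrt m \<noteq> 0" "sqrt (m-1) \<noteq> 0" using m2 by auto
    have s2: "sin (2 * \<theta>) = 2 * sqrt (m - 1) / m"
      using mm m2 by (simp add: sin_double sin cos)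
    have c2: "cos (2 * \<theta>) = 1 - 2 / m"
      using mm m2 by (simp add: cos_double_sin sin power_divide)
    have ang: "(2 * real (Suc k) + 1) * \<theta> = \<phi> + 2 * \<theta>" by (simp add: \<phi>_def algebra_simps)
    \<comment> \<open>\<open>A\<close> and \<open>B\<close> are the addition theorems for the angle
      increment 2 theta, at x and on the rest of S respectively.\<close>
    have A: "-a - 2 * (1 / sqrt m) * (1 / sqrt m * (- a + (m - 1) * b))
        = (-1) ^ Suc k * sin (\<phi> + 2 * \<theta>)"
    proof -
      have "-a - 2 * (1 / sqrt m) * (1 / sqrt m * (- a + (m - 1) * b)) = - a - (2 / m) * (- a + (m - 1) * b)"
        using mm by (simp add: field_simps)
      also have "\<dots> = (-1) ^ Suc k * sin (\<phi> + 2 * \<theta>)"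
      proof -
        have "(m - 1) * b = (-1) ^ k * (cos \<phi> * ((m - 1) / sqrt (m - 1)))" by (simp add: b_def)
        also have "(m - 1) / sqrt (m - 1) = sqrt (m - 1)" using m2 by (simp add: real_div_sqrt)
        finally have mb: "(m - 1) * b = (-1) ^ k * (cos \<phi> * sqrt (m - 1))" .
        show ?thesis
          unfolding mb sin_add s2 c2 a_def using m2 by (simp add: field_simps)
      qed
      finally show ?thesis .
    qed
    have B: "b - 2 * (1 / sqrt m) * (1 / sqrt m * (- a + (m - 1) * b))
        = (-1) ^ Suc k * (cos (\<phi> + 2 * \<theta>) / sqrt (m - 1))"
    proof -
      have "b - 2 * (1 / sqrt m) * (1 / sqrt m * (- a + (m - 1) * b)) = b - (2 / m) * (- a + (m - 1) * b)"
        using mm by (simp add: field_simps)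
      also have "\<dots> = - (1 - 2 / m) * b + 2 / m * a" using m2 by (simp add: field_simps)
      also have "\<dots> = (-1) ^ Suc k * (cos (\<phi> + 2 * \<theta>) / sqrt (m - 1))"
        unfolding cos_add s2 c2 a_def b_def using m2 mm(4) by (simp add: field_simps)
      finally show ?thesis .
    qed
    have "psi S i = of_real (if i \<in> S then 1 / sqrt m else 0)"
      by (simp add: psi_def m_def)
    then have "grover_vec N x S (Suc k) i = of_real ((if i = x then -a else if i \<in> S then b else 0)
         - 2 * (if i \<in> S then 1 / sqrt m else 0) * (1 / sqrt m * (- a + (m - 1) * b)))"
      unfolding g of_real_diff of_real_mult by simp
    also have "(if i = x then -a else if i \<in> S then b else 0)
         - 2 * (if i \<in> S then 1 / sqrt m else 0) * (1 / sqrt m * (- a + (m - 1) * b))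
       = (-1) ^ Suc k * (if i = x then sin (\<phi> + 2 * \<theta>)
           else if i \<in> S then cos (\<phi> + 2 * \<theta>) / sqrt (m - 1) else 0)"
      using A B S(2) by (cases "i = x"; cases "i \<in> S") (simp_all only: if_True if_False mult_zero_left mult_zero_right diff_self simp_thms)
    finally show ?case unfolding m1 ang .
  }
qed

section \<open>The chord of the sine and the length of a round\<close>

lemma sin_ge_chord:
  fixes x a :: real
  assumes "0 \<le> x" "x \<le> a" "0 < a" "a \<le> pi"
  shows "sin a / a * x \<le> sin x"
proof -
  \<comment> \<open>Concavity puts the sine above its chord over [0, a]. The instances used later
    are a = pi/6 and a = pi/2.\<close>
  have "concave_on {0..pi} sin"
    by (rule f''_le0_imp_concave[where f' = cos and f'' = "\<lambda>x. - sin x"])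
      (auto intro!: derivative_eq_intros sin_ge_zero)
  from concave_onD[OF this, of "x / a" 0 a] assms show ?thesis
    by (simp add: mult.commute)
qed

lemma alpha_eq: "0 \<le> 1 + real g / (10 * ln (1 / \<epsilon>)) \<Longrightarrow> alpha \<epsilon> g = 1 / sqrt (1 + real g / (10 * ln (1 / \<epsilon>)))"
  by (simp add: alpha_def powr_minus_divide powr_half_sqrt)

lemma kg_le:
  assumes "0 < \<epsilon>" "\<epsilon> < 1"
  shows "real (kg N \<epsilon> g q) \<le> alpha \<epsilon> g * (pi / 4) * sqrt (real N)"
proof -
  have L: "0 < ln (1 / \<epsilon>)" using assms by simp
  have a: "0 \<le> alpha \<epsilon> g" by (simp add: alpha_def)
  have "real (nat \<lfloor>alpha \<epsilon> g * (pi / 4) * sqrt (real N - real g)\<rfloor>) \<le> alpha \<epsilon> g * (pi / 4) * sqrt (real N)"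
  \<comment> \<open>For g > N the argument of \<open>sqrt\<close> is negative, and so is its value,
    \<open>sqrt\<close> being odd; \<open>nat\<close> then truncates the floor to 0.\<close>
  proof (cases "0 \<le> \<lfloor>alpha \<epsilon> g * (pi / 4) * sqrt (real N - real g)\<rfloor>")
    case True
    then have "real (nat \<lfloor>alpha \<epsilon> g * (pi / 4) * sqrt (real N - real g)\<rfloor>) \<le> alpha \<epsilon> g * (pi / 4) * sqrt (real N - real g)"
      by linarith
    also have "\<dots> \<le> alpha \<epsilon> g * (pi / 4) * sqrt (real N)"
      using a by (intro mult_left_mono) auto
    finally show ?thesis .
  qed (use a in simp)
  then show ?thesis using a by (simp add: kg_def)
qed

lemma alpha_le_1:
  assumes "0 < \<epsilon>" "\<epsilon> < 1"
  shows "alpha \<epsilon> g \<le> 1"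
proof -
  have "0 < ln (1 / \<epsilon>)" using assms by simp
  then have "1 \<le> 1 + real g / (10 * ln (1 / \<epsilon>))" by (simp only: le_add_same_cancel1) simp
  moreover from this have "1 \<le> sqrt (1 + real g / (10 * ln (1 / \<epsilon>)))" by (simp only: real_sqrt_ge_1_iff)
  ultimately show ?thesis by (subst alpha_eq) (auto simp del: real_sqrt_ge_1_iff)
qed

section \<open>Recursion for the failure probability\<close>

text \<open>The diagonal of the state sums to 1, so the outcomes other than x carry total weight at
  most 1 - s. Any lower bound \<open>s\<close> is allowed; s = 0 handles rounds whose success is not
  credited.\<close>

lemma notfound_step:
  assumes T: "quantum_channel N T" and p: "0 \<le> p" "p \<le> 1"
    and S: "S \<subseteq> {..<N}" "x \<in> S"
    and k: "k = kg N \<epsilon> g q" and Q: "real (q + k + 1) \<le> Q" and B: "0 \<le> B"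
    and s: "s \<le> Re (round_state N p T x S k x x)"
    and next_le: "\<And>r. r < N \<Longrightarrow> r \<noteq> x \<Longrightarrow> notfound N \<epsilon> p T x Q f (Suc g) (S - {r}) (q + k + 1) \<le> B"
  shows "notfound N \<epsilon> p T x Q (Suc f) g S q \<le> (1 - s) * B"
proof -
  define \<rho> where "\<rho> = round_state N p T x S k"
  have x: "x < N" using S by auto
  have S': "S \<noteq> {}" using S by auto
  have "notfound N \<epsilon> p T x Q (Suc f) g S q = (\<Sum>r<N. if r = x then 0
      else Re (\<rho> r r) * notfound N \<epsilon> p T x Q f (Suc g) (S - {r}) (q + k + 1))"
    using Q by (simp add: Let_def k[symmetric] \<rho>_def cong: if_cong)
  also have "\<dots> = (\<Sum>r\<in>{..<N} - {x}. Re (\<rho> r r) * notfound N \<epsilon> p T x Q f (Suc g) (S - {r}) (q + k + 1))"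
    using x by (subst sum.remove[of _ x]) auto
  also have "\<dots> \<le> (\<Sum>r\<in>{..<N} - {x}. Re (\<rho> r r) * B)"
    using next_le round_state_nonneg[OF T p S(1) S'] unfolding \<rho>_def
    by (intro sum_mono mult_left_mono) auto
  also have "\<dots> = (1 - Re (\<rho> x x)) * B"
    using round_state_sum[OF T p S(1) S', of x k] sum.remove[of "{..<N}" x "\<lambda>r. Re (\<rho> r r)"] x
    by (simp add: \<rho>_def flip: sum_distrib_right)
  also have "\<dots> \<le> (1 - s) * B"
    using s B unfolding \<rho>_def by (intro mult_right_mono) auto
  finally show ?thesis .
qed

lemma notfound_le_1:
  assumes "quantum_channel N T" "0 \<le> p" "p \<le> 1" "S \<subseteq> {..<N}" "x \<in> S"
  shows "notfound N \<epsilon> p T x Q f g S q \<le> 1"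
  using assms(4,5)
proof (induction f arbitrary: g S q)
  case (Suc f)
  show ?case
  proof (cases "real (q + kg N \<epsilon> g q + 1) \<le> Q")
    case True
    have "notfound N \<epsilon> p T x Q (Suc f) g S q \<le> (1 - 0) * 1"
      using Suc.prems assms(1-3) round_state_nonneg[OF assms(1-3) Suc.prems(1)]
      by (intro notfound_step[OF assms(1-3) Suc.prems refl True] Suc.IH) auto
    then show ?thesis by simp
  qed (simp add: Let_def)
qed simp

(* Once the switch to classical search has happened, the outcomes are drawn from S without replacement. *)
lemma notfound_classical:
  assumes "(1 - \<epsilon>) * real N < real q" "S \<subseteq> {..<N}" "x \<in> S" "j \<le> card S" "j \<le> f" "real (q + j) \<le> Q"
    and T: "quantum_channel N T" "0 \<le> p" "p \<le> 1"
  shows "notfound N \<epsilon> p T x Q f g S q \<le> (real (card S) - real j) / real (card S)"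
  using assms(1-6)
proof (induction j arbitrary: f g S q)
  case 0
  then have "finite S" by (meson finite_lessThan finite_subset)
  then have "0 < card S" using 0 by (auto simp: card_gt_0_iff)
  then show ?case using notfound_le_1[OF T 0(2,3)] by simp
next
  case (Suc j)
  then obtain f' where f: "f = Suc f'" by (cases f) auto
  have fin: "finite S" using Suc.prems(2) by (meson finite_lessThan finite_subset)
  have m0: "0 < card S" using Suc.prems(3) fin by (auto simp: card_gt_0_iff)
  have k: "kg N \<epsilon> g q = 0" using Suc.prems(1) by (simp add: kg_def)
  \<comment> \<open>Without iterations the measured state is the fresh superposition, so the outcome
    is uniform on S and noise has no occasion to act.\<close>
  have "Re (round_state N p T x S 0 r r) = (if r \<in> S then 1 / card S else 0)" for r
    by (simp add: round_state_def psi_def flip: of_real_mult)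
  then have "notfound N \<epsilon> p T x Q f g S q = (\<Sum>r<N. if r = x then 0 else (if r \<in> S then 1 / card S else 0)
      * notfound N \<epsilon> p T x Q f' (Suc g) (S - {r}) (q + 1))"
    using Suc.prems(6) by (simp add: f Let_def k cong: if_cong)
  also have "\<dots> = (\<Sum>r\<in>S - {x}. 1 / card S * notfound N \<epsilon> p T x Q f' (Suc g) (S - {r}) (q + 1))"
    using Suc.prems(2) by (intro sum.mono_neutral_cong_right) auto
  also have "\<dots> \<le> (\<Sum>r\<in>S - {x}. 1 / card S * ((real (card S - 1) - real j) / real (card S - 1)))"
  proof (intro sum_mono mult_left_mono)
    fix r assume r: "r \<in> S - {x}"
    then have c: "card (S - {r}) = card S - 1" using fin by simp
    show "notfound N \<epsilon> p T x Q f' (Suc g) (S - {r}) (q + 1) \<le> (real (card S - 1) - real j) / real (card S - 1)"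
      using Suc.prems r unfolding c[symmetric] by (intro Suc.IH) (auto simp: c f)
  qed simp
  also have "\<dots> = real (card S - 1) / card S * ((real (card S - 1) - real j) / real (card S - 1))"
    using Suc.prems(3) fin by (simp add: card_Diff_singleton)
  also have "\<dots> \<le> (real (card S) - real (Suc j)) / real (card S)"
  proof -
    obtain n where n: "card S = Suc n" using m0 gr0_implies_Suc by blast
    show ?thesis
    \<comment> \<open>For card S = 1 the second fraction is 0/0 = 0; then j = 0 and both sides
      vanish. Otherwise the factor n cancels.\<close>
    proof (cases "n = 0")
      case False
      then have "real n / real (Suc n) * ((real n - real j) / real n) = (real n - real j) / real (Suc n)" by simp
      moreover have "real (Suc n) - real (Suc j) = real n - real j" by simp
      ultimately show ?thesis unfolding n diff_Suc_1 by (simp only: order_refl)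
    qed (use Suc.prems(4) n in simp)
  qed
  finally show ?case .
qed

text \<open>Carries a bound for the classical phase back to any earlier point, crediting the quantum
  rounds with no success. A round starting at or below the threshold (1 - eps) N uses at most (pi/4)
  sqrt N + 1 queries, which bounds the overshoot at the switch.\<close>

lemma notfound_quantum_phase:
  assumes T: "quantum_channel N T" "0 \<le> p" "p \<le> 1" and \<epsilon>: "0 < \<epsilon>" "\<epsilon> < 1" and B: "0 \<le> B"
    and Q: "(1 - \<epsilon>) * real N + (pi / 4) * sqrt (real N) + 1 \<le> Q"
    and classical: "\<And>f g S q. (1 - \<epsilon>) * real N < real q \<Longrightarrow>
      real q \<le> (1 - \<epsilon>) * real N + (pi / 4) * sqrt (real N) + 1 \<Longrightarrow> S \<subseteq> {..<N} \<Longrightarrow> x \<in> S \<Longrightarrow>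
      Q < real (f + q) \<Longrightarrow> notfound N \<epsilon> p T x Q f g S q \<le> B"
    and q: "real q \<le> (1 - \<epsilon>) * real N" and S: "S \<subseteq> {..<N}" "x \<in> S" and f: "Q < real (f + q)"
  shows "notfound N \<epsilon> p T x Q f g S q \<le> B"
  using q S f
proof (induction f arbitrary: g S q)
  case 0
  have "0 \<le> (pi / 4) * sqrt (real N)" by simp
  with 0 Q show ?case by simp
next
  case (Suc f)
  define k where "k = kg N \<epsilon> g q"
  have "real k \<le> alpha \<epsilon> g * ((pi / 4) * sqrt (real N))" unfolding k_def using kg_le[OF \<epsilon>] by (simp add: mult.assoc)
  also have "\<dots> \<le> 1 * ((pi / 4) * sqrt (real N))" by (intro mult_right_mono alpha_le_1 \<epsilon>) simp
  finally have k: "real k \<le> (pi / 4) * sqrt (real N)" by simp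
  have "notfound N \<epsilon> p T x Q (Suc f) g S q \<le> (1 - 0) * B"
  proof (rule notfound_step[OF T Suc.prems(2,3) k_def _ B])
    show "real (q + k + 1) \<le> Q" using k Suc.prems Q by simp
    show "0 \<le> Re (round_state N p T x S k x x)"
      using Suc.prems by (intro round_state_nonneg T) auto
  next
    fix r assume "r < N" "r \<noteq> x"
    then show "notfound N \<epsilon> p T x Q f (Suc g) (S - {r}) (q + k + 1) \<le> B"
    proof (cases "real (q + k + 1) \<le> (1 - \<epsilon>) * real N")
      case True
      then show ?thesis using Suc.prems \<open>r \<noteq> x\<close> by (intro Suc.IH) auto
    next
      case False
      then show ?thesis using Suc.prems \<open>r \<noteq> x\<close> k by (intro classical) auto
    qed
  qed
  then show ?case by simp
qed

section \<open>Query counts and products over rounds\<close>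

text \<open>The schedule does not depend on measurement outcomes, so the number of queries spent
  before round g is a function of g.\<close>

fun queries :: "nat \<Rightarrow> real \<Rightarrow> nat \<Rightarrow> nat" where
  "queries N \<epsilon> 0 = 0"
| "queries N \<epsilon> (Suc g) = queries N \<epsilon> g + kg N \<epsilon> g (queries N \<epsilon> g) + 1"

lemma queries_mono: "g \<le> h \<Longrightarrow> queries N \<epsilon> g \<le> queries N \<epsilon> h"
  by (induction h rule: dec_induct) auto

text \<open>The bound \<open>s i\<close> must hold for every set that can occur in round i. Noise
  may produce an outcome outside the current set, which then does not shrink; hence only N <= card S
  + i is known, not equality.\<close>

lemma notfound_le_prod:
  assumes T: "quantum_channel N T" "0 \<le> p" "p \<le> 1"
    and Q: "real (queries N \<epsilon> G) \<le> Q"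
    and s: "\<And>i. s i \<le> 1"
      "\<And>i S. i < G \<Longrightarrow> S \<subseteq> {..<N} \<Longrightarrow> x \<in> S \<Longrightarrow> N \<le> card S + i \<Longrightarrow>
        s i \<le> Re (round_state N p T x S (kg N \<epsilon> i (queries N \<epsilon> i)) x x)"
    and g: "g \<le> G" and S: "S \<subseteq> {..<N}" "x \<in> S" "N \<le> card S + g" and f: "Q < real (f + queries N \<epsilon> g)"
  shows "notfound N \<epsilon> p T x Q f g S (queries N \<epsilon> g) \<le> (\<Prod>i\<in>{g..<G}. 1 - s i)"
  using g S f
proof (induction g arbitrary: f S rule: inc_induct)
  case base
  then show ?case using notfound_le_1[OF T base.prems(1,2)] by simp
next
  case (step g)
  have qQ: "real (queries N \<epsilon> (Suc g)) \<le> Q"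
    using Q queries_mono[of "Suc g" G N \<epsilon>] step.hyps by linarith
  then have "f \<noteq> 0" using step.prems(4) by (intro notI) simp
  then obtain f' where f: "f = Suc f'" by (cases f) auto
  have fin: "finite S" using step.prems(1) by (meson finite_lessThan finite_subset)
  have "notfound N \<epsilon> p T x Q (Suc f') g S (queries N \<epsilon> g) \<le> (1 - s g) * (\<Prod>i\<in>{Suc g..<G}. 1 - s i)"
  proof (rule notfound_step[OF T step.prems(1,2) refl])
    show "real (queries N \<epsilon> g + kg N \<epsilon> g (queries N \<epsilon> g) + 1) \<le> Q" using qQ by simp
    show "0 \<le> (\<Prod>i\<in>{Suc g..<G}. 1 - s i)" by (intro prod_nonneg) (simp add: s(1))
    show "s g \<le> Re (round_state N p T x S (kg N \<epsilon> g (queries N \<epsilon> g)) x x)"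
      using step by (intro s(2)) auto
  next
    fix r assume "r < N" "r \<noteq> x"
    have "card S \<le> card (S - {r}) + 1" using card_Suc_Diff1[OF fin, of r] by (cases "r \<in> S") simp_all
    then have "notfound N \<epsilon> p T x Q f' (Suc g) (S - {r}) (queries N \<epsilon> (Suc g)) \<le> (\<Prod>i\<in>{Suc g..<G}. 1 - s i)"
      using step.prems \<open>r \<noteq> x\<close> by (intro step.IH) (auto simp: f)
    then show "notfound N \<epsilon> p T x Q f' (Suc g) (S - {r}) (queries N \<epsilon> g + kg N \<epsilon> g (queries N \<epsilon> g) + 1)
        \<le> (\<Prod>i\<in>{Suc g..<G}. 1 - s i)" by simp
  qed
  then show ?case using step.hyps by (simp add: f prod.atLeast_Suc_lessThan)
qed

text \<open>Comparison with the integral of (1 + t/c)^(-1/2) over [0, n]; the leading 1 is the term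
  g = 0. Its discrete form 1/b <= 2 c (b - a) comes from c (b^2 - a^2) = 1 and a <= b.\<close>

lemma sum_inverse_sqrt_le:
  fixes c :: real
  assumes "0 < c"
  shows "(\<Sum>g<Suc n. 1 / sqrt (1 + real g / c)) \<le> 1 + 2 * c * (sqrt (1 + real n / c) - 1)"
proof (induction n)
  case (Suc n)
  define a where "a = sqrt (1 + real n / c)"
  define b where "b = sqrt (1 + real (Suc n) / c)"
  have ab: "a\<^sup>2 = 1 + real n / c" "b\<^sup>2 = 1 + real (Suc n) / c" "a \<ge> 0" "b > 0" "a \<le> b"
    using assms by (auto simp: a_def b_def add_pos_nonneg divide_right_mono)
  have "c * (b\<^sup>2 - a\<^sup>2) = 1" unfolding ab using assms by (simp add: field_simps)
  then have "c * (b - a) * (b + a) = 1" by (simp add: power2_eq_square algebra_simps)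
  moreover have "c * (b - a) * (b + a) \<le> c * (b - a) * (2 * b)"
    using assms ab by (intro mult_left_mono) auto
  ultimately have "1 / b \<le> 2 * c * (b - a)" using ab by (simp add: field_simps)
  then have "(\<Sum>g<Suc (Suc n). 1 / sqrt (1 + real g / c)) \<le> 1 + 2 * c * (a - 1) + 2 * c * (b - a)"
    using Suc.IH by (simp add: a_def b_def)
  also have "\<dots> = 1 + 2 * c * (b - 1)" by (simp add: algebra_simps)
  finally show ?case unfolding b_def .
qed simp

lemma queries_le:
  assumes "0 < \<epsilon>" "\<epsilon> < 1"
  defines "c \<equiv> 10 * ln (1 / \<epsilon>)"
  shows "real (queries N \<epsilon> (Suc n)) \<le> (pi / 4) * sqrt N * (1 + 2 * c * (sqrt (1 + real n / c) - 1)) + real (Suc n)"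
proof -
  have c: "0 < c" using assms by (simp add: c_def)
  have "real (queries N \<epsilon> G) \<le> (pi / 4) * sqrt N * (\<Sum>g<G. 1 / sqrt (1 + real g / c)) + real G" for G
  proof (induction G)
    case (Suc G)
    have "alpha \<epsilon> G = 1 / sqrt (1 + real G / c)"
      using c unfolding c_def by (intro alpha_eq) simp
    with kg_le[OF assms(1,2), of N G "queries N \<epsilon> G"]
    have "real (kg N \<epsilon> G (queries N \<epsilon> G)) \<le> (pi / 4) * sqrt N * (1 / sqrt (1 + real G / c))"
      by (simp add: mult_ac)
    with Suc show ?case by (simp add: distrib_left)
  qed simp
  also have "(\<Sum>g<Suc n. 1 / sqrt (1 + real g / c)) \<le> 1 + 2 * c * (sqrt (1 + real n / c) - 1)"
    by (rule sum_inverse_sqrt_le[OF c])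
  finally show ?thesis by (simp add: mult_left_mono)
qed

section \<open>Success probability of one round\<close>

lemma arcsin_le:
  fixes z :: real
  assumes "0 \<le> z" "z \<le> 1 / 2"
  shows "arcsin z \<le> (pi / 3) * z"
proof -
  have "arcsin z \<le> pi / 6"
    using assms by (subst arcsin_le_iff) (auto simp: sin_30)
  moreover have "0 \<le> arcsin z"
    using assms by (simp add: le_arcsin_iff)
  \<comment> \<open>The factor pi/3 is arcsin (1/2) divided by 1/2, from the chord over
    [0, pi/6].\<close>
  ultimately have "sin (pi / 6) / (pi / 6) * arcsin z \<le> sin (arcsin z)"
    by (intro sin_ge_chord) auto
  also have "\<dots> = z" using assms by simp
  finally show ?thesis by (simp add: sin_30 field_simps)
qed

lemma arcsin_ge:
  fixes z :: real
  assumes "0 \<le> z" "z \<le> 1"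
  shows "z \<le> arcsin z"
proof -
  have "0 \<le> arcsin z" using assms by (simp add: le_arcsin_iff)
  from sin_x_le_x[OF this] show ?thesis using assms by simp
qed

text \<open>Noise costs a factor of at least 0.37, since p k <= pi/5. The angle stays below pi/2, so
  the chord of the sine applies and gives a sine of at least 0.9/u. Finally 0.37 * 0.81 >=
  0.29.\<close>

lemma grover_round_bound:
  fixes N m :: nat and p L D u v g y :: real
  assumes L: "2 / 3 \<le> L" and p: "0 \<le> p" "p \<le> 1" and D: "D = 1 + p * sqrt N"
    and N: "49 * L * D \<le> sqrt N" and u: "u = 5 / 2 * D" and v: "u / 2 \<le> v" "v \<le> u"
    and g: "g = 10 * L * (v\<^sup>2 - 1)"
    and m: "real N - g \<le> real m" "m \<le> N"
    and y: "y = 1 / v * (pi / 4) * sqrt (N - g)"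
  shows "(29 / 100) / u\<^sup>2 \<le> (1 - p) ^ (nat \<lfloor>y\<rfloor>) * (sin ((2 * real (nat \<lfloor>y\<rfloor>) + 1) * arcsin (1 / sqrt m)))\<^sup>2"
proof -
  define s where "s = sqrt (real N)"
  define k where "k = nat \<lfloor>y\<rfloor>"
  define \<theta> where "\<theta> = arcsin (1 / sqrt m)"
  note pi = pi_approx pi_gt3
  have D1: "1 \<le> D" unfolding D using p by simp
  have LD: "2 / 3 * D \<le> L * D" using L D1 by (intro mult_right_mono) auto
  have s: "32 * D \<le> s" using N LD D1 unfolding s_def by linarith
  have s32: "32 \<le> s" using s D1 by linarith
  have s2: "s\<^sup>2 = real N" by (simp add: s_def)
  have v1: "5 / 4 \<le> v" using v(1) D1 unfolding u by linarith
  have v0: "0 < v" "0 < u" using v1 D1 unfolding u by linarith+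
  have g0: "0 \<le> g" using v1 L unfolding g by (intro mult_nonneg_nonneg) (auto simp: abs_le_square_iff[of 1 v, simplified])
  \<comment> \<open>Few elements have been removed: 10 L u^2 = 62.5 L D^2 <= 93.75 (L D)^2, and L D
    <= s/49, which gives about 0.0391 s^2. Then \<open>t_ge\<close> follows from 0.979^2 <=
    0.96.\<close>
  have gN: "g \<le> s\<^sup>2 * (4 / 100)"
  proof -
    have "v\<^sup>2 \<le> u\<^sup>2" using v v0 by (intro power_mono) auto
    then have "g \<le> 10 * L * u\<^sup>2" unfolding g using L by (intro mult_left_mono) auto
    also have "\<dots> = (10 * 25 / 4) * (L * D\<^sup>2)" by (simp add: u power2_eq_square)
    also have "\<dots> \<le> (10 * 25 / 4) * (3 / 2 * (L * D)\<^sup>2)"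
    proof (intro mult_left_mono)
      have "L * D\<^sup>2 * (2/3) \<le> L * D\<^sup>2 * L" using L by (intro mult_left_mono) auto
      then show "L * D\<^sup>2 \<le> 3 / 2 * (L * D)\<^sup>2" by (simp add: power2_eq_square algebra_simps)
    qed simp
    also have "\<dots> \<le> (10 * 25 / 4) * (3 / 2 * (s / 49)\<^sup>2)"
      using N L D1 unfolding s_def by (intro mult_left_mono power_mono) auto
    also have "\<dots> \<le> s\<^sup>2 * (4 / 100)" by (simp add: power_divide)
    finally show ?thesis .
  qed
  define t where "t = sqrt (real N - g)"
  have t_le: "t \<le> s" unfolding t_def s_def using g0 by simp
  have t_ge: "979 / 1000 * s \<le> t"
  proof -
    have "(979 / 1000 * s)\<^sup>2 = 958441 / 1000000 * s\<^sup>2"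
      by (simp add: power_mult_distrib power_divide)
    then have "(979 / 1000 * s)\<^sup>2 \<le> real N - g" using gN s2 by linarith
    then show ?thesis unfolding t_def by (rule real_le_rsqrt)
  qed
  have t0: "0 < t" using t_ge s32 by linarith
  have tm: "t \<le> sqrt m" unfolding t_def using m by simp
  have m0: "0 < sqrt m" using tm t0 by linarith
  have ms: "sqrt m \<le> s" unfolding s_def using m by simp
  have yt: "y = (pi / 4) * t / v" unfolding y t_def by simp
  have y0: "0 \<le> y" unfolding yt using t0 v0 by simp
  have k: "real k \<le> y" "y - 1 < real k" using y0 unfolding k_def by linarith+

  have "p * real k \<le> 63 / 100"
  proof -
    have "y \<le> (pi / 4) * s / (u / 2)"
      unfolding yt using t_le t0 v v0 by (intro frac_le mult_left_mono) auto
    then have "p * real k \<le> p * ((pi / 4) * s / (u / 2))"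
      using p k(1) by (intro mult_left_mono) auto
    \<comment> \<open>Here p s = D - 1 is what makes the bound independent of p.\<close>
    also have "\<dots> = (pi / 5) * ((D - 1) / D)" using D1 by (simp add: u D s_def field_simps)
    also have "\<dots> \<le> (pi / 5) * 1" using D1 by (intro mult_left_mono) auto
    also have "\<dots> \<le> 63 / 100" using pi by simp
    finally show ?thesis .
  qed
  moreover have "1 + real k * (- p) \<le> (1 + - p) ^ k" using p by (intro Bernoulli_inequality) simp
  ultimately have noise: "37 / 100 \<le> (1 - p) ^ k" by (simp add: mult.commute)

  have z: "0 \<le> 1 / sqrt m" "1 / sqrt m \<le> 1 / 30"
    using m0 tm t_ge s32 by (auto simp: divide_simps)
  have th0: "1 / sqrt m \<le> \<theta>" unfolding \<theta>_def using z by (intro arcsin_ge) auto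
  have th1: "\<theta> \<le> (pi / 3) * (1 / sqrt m)" unfolding \<theta>_def using z by (intro arcsin_le) auto
  \<comment> \<open>No overshooting: v >= 5/4 shortens the round enough to absorb both the extra
    half iteration and the factor pi/3 > 1 from \<open>arcsin_le\<close>.\<close>
  have \<phi>_le: "(2 * real k + 1) * \<theta> \<le> pi / 2"
  proof -
    have "y \<le> (pi / 4) * sqrt m / (5 / 4)"
      unfolding yt using tm t0 v1 by (intro frac_le mult_left_mono) auto
    then have "2 * real k + 1 \<le> (2 * pi / 5) * sqrt m + 1" using k by (simp add: field_simps)
    then have "(2 * real k + 1) * \<theta> \<le> ((2 * pi / 5) * sqrt m + 1) * ((pi / 3) * (1 / sqrt m))"
      using th1 order_trans[OF z(1) th0] by (intro mult_mono) auto
    also have "\<dots> = (pi / 2) * (4 * pi / 15 + 2 / 3 * (1 / sqrt m))" using m0 by (simp add: field_simps)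
    also have "\<dots> \<le> (pi / 2) * 1" using z pi by (intro mult_left_mono) auto
    finally show ?thesis by simp
  qed
  \<comment> \<open>Rounding down loses less than one iteration, so 2 k + 1 > 2 y - 1; and theta >=
    1 / sqrt m >= 1 / s.\<close>
  have "(2 * y - 1) * (1 / s) \<le> (2 * real k + 1) * \<theta>"
  proof -
    have "(2 * y - 1) * (1 / s) \<le> (2 * real k + 1) * (1 / s)"
      using k s32 by (intro mult_right_mono) auto
    also have "\<dots> \<le> (2 * real k + 1) * \<theta>"
    proof (intro mult_left_mono)
      have "1 / s \<le> 1 / sqrt m" using ms m0 s32 by (intro divide_left_mono mult_pos_pos) linarith+
      then show "1 / s \<le> \<theta>" using th0 by linarith
    qed simp
    finally show ?thesis .
  qed
  then have "(2 / pi) * ((2 * y - 1) * (1 / s)) \<le> (2 / pi) * ((2 * real k + 1) * \<theta>)"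
    by (intro mult_left_mono) auto
  also have "\<dots> \<le> sin ((2 * real k + 1) * \<theta>)"
    using sin_ge_chord[of "(2 * real k + 1) * \<theta>" "pi / 2"] \<phi>_le th0 z by simp
  also have "(2 / pi) * ((2 * y - 1) * (1 / s)) = t / s * (1 / v) - 2 / pi * (1 / s)"
    using v0 s32 by (simp add: yt field_simps)
  finally have "t / s * (1 / v) - 2 / pi * (1 / s) \<le> sin ((2 * real k + 1) * \<theta>)" .
  moreover have "979 / 1000 * (1 / u) \<le> t / s * (1 / v)"
    using t_ge s32 v v0 by (intro mult_mono divide_left_mono) (auto simp: field_simps)
  moreover have "2 / pi * (1 / s) \<le> 2 / 3 * (5 / 64 * (1 / u))"
  proof (intro mult_mono)
    have "1 / s \<le> 1 / (32 * D)" using s D1 by (intro divide_left_mono) auto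
    then show "1 / s \<le> 5 / 64 * (1 / u)" by (simp add: u)
    show "2 / pi \<le> 2 / 3" using pi by (intro divide_left_mono) auto
  qed (use s32 in auto)
  moreover have "979 / 1000 * (1 / u) - 2 / 3 * (5 / 64 * (1 / u)) \<ge> 9 / 10 * (1 / u)"
    using v0 by (simp add: field_simps)
  ultimately have "9 / 10 * (1 / u) \<le> sin ((2 * real k + 1) * \<theta>)" by linarith
  then have "(9 / 10 * (1 / u))\<^sup>2 \<le> (sin ((2 * real k + 1) * \<theta>))\<^sup>2"
    using v0 by (intro power_mono) auto
  then have "37 / 100 * (9 / 10 * (1 / u))\<^sup>2 \<le> (1 - p) ^ k * (sin ((2 * real k + 1) * \<theta>))\<^sup>2"
    using noise by (intro mult_mono) auto
  moreover have "(29 / 100) / u\<^sup>2 \<le> 37 / 100 * (9 / 10 * (1 / u))\<^sup>2"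
    using v0 by (simp add: power_divide power_mult_distrib field_simps)
  ultimately show ?thesis unfolding k_def \<theta>_def by linarith
qed

lemma one_minus_power_le_exp:
  fixes s :: real
  assumes "s \<le> 1"
  shows "(1 - s) ^ n \<le> exp (- (s * real n))"
proof -
  have "(1 - s) ^ n \<le> exp (- s) ^ n"
    using assms exp_ge_add_one_self[of "- s"] by (intro power_mono) auto
  then show ?thesis by (simp add: mult.commute flip: exp_of_nat_mult)
qed

lemma round_state_success_sin:
  assumes "quantum_channel N T" "0 \<le> p" "p \<le> 1" "S \<subseteq> {..<N}" "x \<in> S" "2 \<le> card S"
  shows "(1 - p) ^ k * (sin ((2 * real k + 1) * arcsin (1 / sqrt (card S))))\<^sup>2
    \<le> Re (round_state N p T x S k x x)"
proof -
  have "x < N" "S \<noteq> {}" using assms by auto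
  moreover have "(cmod (grover_vec N x S k x))\<^sup>2 = (sin ((2 * real k + 1) * arcsin (1 / sqrt (card S))))\<^sup>2"
    using assms(4-6) \<open>x < N\<close>
    by (simp only: grover_vec_closed_form norm_of_real) (simp add: abs_mult power_mult_distrib)
  ultimately show ?thesis using round_state_success[OF assms(1-4), of x k x] by simp
qed

section \<open>The two budgets and the final bound\<close>

lemma notfound_le_classical_budget:
  assumes T: "quantum_channel N T" "0 \<le> p" "p \<le> 1" and "100 \<le> N" "0 < \<epsilon>" "\<epsilon> < 1" "x < N"
    and Q: "2 * (1 - \<epsilon>) * real N + sqrt (real N) \<le> Q" and f: "Q < real f"
  shows "notfound N \<epsilon> p T x Q f 0 {..<N} 0 \<le> \<epsilon>"
proof -
  define j where "j = nat \<lceil>(1 - \<epsilon>) * real N\<rceil>"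
  have s: "10 \<le> sqrt (real N)" using \<open>100 \<le> N\<close> by (intro real_le_rsqrt) simp
  have pos: "0 \<le> (1 - \<epsilon>) * real N" using assms by simp
  have j: "(1 - \<epsilon>) * real N \<le> real j" "real j \<le> (1 - \<epsilon>) * real N + 1"
    using pos unfolding j_def by linarith+
  \<comment> \<open>The 2 pays for the verification query of the round that crosses the threshold
    and for rounding \<open>j\<close> up. With pi/4 <= 0.8 this needs sqrt N >= 10.\<close>
  have "(pi / 4) * sqrt (real N) + 2 \<le> sqrt (real N)"
  proof -
    have "(pi / 4) * sqrt (real N) \<le> (8 / 10) * sqrt (real N)"
      using pi_approx by (intro mult_right_mono) auto
    with s show ?thesis by linarith
  qed
  with Q have budget: "2 * ((1 - \<epsilon>) * real N) + (pi / 4) * sqrt (real N) + 2 \<le> Q" by (simp add: algebra_simps)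
  show ?thesis
  proof (rule notfound_quantum_phase[OF T])
    show "(1 - \<epsilon>) * real N + (pi / 4) * sqrt (real N) + 1 \<le> Q"
      using budget pos by linarith
  next
    fix f' g S q
    assume q: "(1 - \<epsilon>) * real N < real q" "real q \<le> (1 - \<epsilon>) * real N + (pi / 4) * sqrt (real N) + 1"
      and S: "S \<subseteq> {..<N}" "x \<in> S" and f': "Q < real (f' + q)"
    have m: "0 < card S" "card S \<le> N"
      using S card_mono[of "{..<N}" S] finite_subset[OF S(1)] by (auto simp: card_gt_0_iff)
    \<comment> \<open>If fewer than \<open>j\<close> candidates remain, drawing all of them leaves
      failure probability 0; otherwise j >= (1 - eps) card S draws suffice.\<close>
    define j' where "j' = min j (card S)"
    have "real (q + j') \<le> Q" using q j budget unfolding j'_def by simp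
    then have "notfound N \<epsilon> p T x Q f' g S q \<le> (real (card S) - real j') / real (card S)"
      using f' unfolding j'_def by (intro notfound_classical q S T) auto
    also have "\<dots> \<le> \<epsilon>"
    proof (cases "j \<le> card S")
      case True
      have "(1 - \<epsilon>) * real (card S) \<le> (1 - \<epsilon>) * real N"
        using m assms by (intro mult_left_mono) auto
      then have "real (card S) - real j' \<le> \<epsilon> * real (card S)"
        using True j unfolding j'_def by (simp add: algebra_simps)
      then show ?thesis using m by (simp add: divide_le_eq)
    qed (use assms in \<open>simp add: j'_def\<close>)
    finally show "notfound N \<epsilon> p T x Q f' g S q \<le> \<epsilon>" .
  qed (use assms in auto)
qed

text \<open>All rounds before G fit into A queries, hence precede the switch. Only the rounds from
  \<open>a\<close> to G - 1 are credited with success, each with \<open>\<sigma>\<close>.\<close>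

lemma notfound_le_quantum_budget:
  assumes T: "quantum_channel N T" "0 \<le> p" "p \<le> 1" and N: "100 \<le> N" and \<epsilon>: "0 < \<epsilon>" "\<epsilon> \<le> 1 / 2" and x: "x < N"
  defines "A \<equiv> 49 * (real N * p + sqrt (real N)) * ln (1 / \<epsilon>)"
  assumes A: "A \<le> (1 - \<epsilon>) * real N" and Q: "A \<le> Q" and f: "Q < real f"
  shows "notfound N \<epsilon> p T x Q f 0 {..<N} 0 \<le> \<epsilon>"
proof -
  define s where "s = sqrt (real N)"
  define L where "L = ln (1 / \<epsilon>)"
  define D where "D = 1 + p * s"
  define u where "u = 5 / 2 * D"
  have \<epsilon>1: "\<epsilon> < 1" using \<epsilon> by simp
  have "ln 2 \<le> L" using \<epsilon> unfolding L_def by (subst ln_le_cancel_iff) (auto simp: field_simps)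
  then have L: "2 / 3 \<le> L" using ln2_ge_two_thirds by linarith
  have ss: "s * s = real N" by (simp add: s_def)
  have s0: "0 < s" using N by (simp add: s_def)
  \<comment> \<open>D is chosen so that N p + sqrt N = s D.\<close>
  have A': "A = 49 * (s * D) * L"
    unfolding A_def L_def[symmetric] s_def[symmetric] by (simp add: ss[symmetric] D_def distrib_left mult_ac)
  have D1: "1 \<le> D" unfolding D_def using T s0 by simp
  have LD: "49 * L * D \<le> s"
  proof -
    have "A \<le> 1 * real N" using A \<epsilon> by (elim order_trans) (intro mult_right_mono, auto)
    then have "s * (49 * L * D) \<le> s * s" unfolding A' ss by (simp add: mult_ac)
    then show ?thesis using s0 by simp
  qed
  have LD2: "2 / 3 * D \<le> L * D" using L D1 by (intro mult_right_mono) auto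
  have u: "5 / 2 \<le> u" using D1 by (simp add: u_def)
  have u2: "25 / 4 \<le> u\<^sup>2" using power_mono[OF u, of 2] by (simp add: power_divide)
  have Lu: "10 * L * u\<^sup>2 \<le> (10 * 25 / (4 * 49)) * (s * D)"
  proof -
    have "10 * L * u\<^sup>2 = (10 * 25 / (4 * 49)) * ((49 * L * D) * D)" by (simp add: u_def power2_eq_square)
    also have "\<dots> \<le> (10 * 25 / (4 * 49)) * (s * D)"
      using LD D1 by (intro mult_left_mono mult_right_mono) auto
    finally show ?thesis .
  qed
  \<comment> \<open>Solving v = u and v = u/2 for the round number gives the ends \<open>w\<close>
    of the window and, below, \<open>a\<close>, up to rounding.\<close>
  define w where "w = 10 * L * (u\<^sup>2 - 1)"
  define G where "G = nat \<lfloor>w\<rfloor>"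
  define a where "a = nat \<lceil>10 * L * (u\<^sup>2 / 4 - 1)\<rceil>"
  have "10 * (2 / 3) * (25 / 4 - 1) \<le> w" unfolding w_def using L u2 by (intro mult_mono) auto
  then have "1 \<le> w" by simp
  then have "real G \<le> w" "w - 1 < real G" "1 \<le> G"
    unfolding G_def by linarith+
  then have G: "real G \<le> 10 * L * (u\<^sup>2 - 1)" "10 * L * (u\<^sup>2 - 1) - 1 < real G" "1 \<le> G"
    unfolding w_def by auto
  have "0 \<le> 10 * L * (u\<^sup>2 / 4 - 1)" using L u2 by simp
  then have a: "10 * L * (u\<^sup>2 / 4 - 1) \<le> real a" "real a \<le> 10 * L * (u\<^sup>2 / 4 - 1) + 1"
    unfolding a_def by linarith+
  have GN: "real G \<le> real N / 2"
  proof -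
    have "D \<le> s / 32" using LD LD2 D1 by linarith
    then have "s * D \<le> s * (s / 32)" using s0 by (intro mult_left_mono) auto
    then have "s * D \<le> real N / 32" using ss by simp
    then have "10 * L * u\<^sup>2 \<le> real N / 2" using Lu N by linarith
    then show ?thesis using G(1) L by (simp add: algebra_simps)
  qed
  have v_le: "sqrt (1 + real i / (10 * L)) \<le> u" if "i \<le> G" for i
  proof -
    have "real i \<le> 10 * L * (u\<^sup>2 - 1)" using that G(1) by linarith
    then have "1 + real i / (10 * L) \<le> u\<^sup>2" using L by (simp add: field_simps)
    then show ?thesis using u by (intro real_le_lsqrt) auto
  qed

  \<comment> \<open>In units of s L D, the Grover iterations cost at most 0.8 * 50 = 40 and the
    verifications at most 2, within the 49 of A.\<close>
  have qA: "real (queries N \<epsilon> G) \<le> A"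
  proof -
    obtain n where n: "G = Suc n" using G(3) by (cases G) auto
    have "real (queries N \<epsilon> G) \<le> (pi / 4) * s * (1 + 20 * L * (sqrt (1 + real n / (10 * L)) - 1)) + real G"
      using queries_le[OF \<epsilon>(1) \<epsilon>1, of N n] unfolding n s_def L_def by simp
    also have "\<dots> \<le> (pi / 4) * s * (1 + 20 * L * (u - 1)) + 10 * L * (u\<^sup>2 - 1)"
      using v_le[of n] G(1) L s0 n by (intro add_mono mult_left_mono) auto
    also have "\<dots> \<le> (8 / 10) * (s * (50 * (L * D))) + 2 * (L * D) * s"
    proof (intro add_mono)
      have "1 + 20 * L * (u - 1) \<le> 50 * (L * D)" "0 \<le> L * (u - 1)"
        using L u by (auto simp: u_def algebra_simps)
      then have "(pi / 4) * (s * (1 + 20 * L * (u - 1))) \<le> (8 / 10) * (s * (50 * (L * D)))"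
        using s0 pi_approx by (intro mult_mono mult_left_mono) auto
      then show "(pi / 4) * s * (1 + 20 * L * (u - 1)) \<le> (8 / 10) * (s * (50 * (L * D)))" by (simp add: mult.assoc)
      have "s * D * (2 / 3) \<le> s * D * L" using L s0 D1 by (intro mult_left_mono) auto
      moreover have "0 \<le> s * D * L" using L s0 D1 by simp
      ultimately show "10 * L * (u\<^sup>2 - 1) \<le> 2 * (L * D) * s" using Lu L by (simp add: algebra_simps)
    qed
    also have "\<dots> \<le> A" using s0 L D1 unfolding A' by (simp add: mult_ac)
    finally show ?thesis .
  qed

  define \<sigma> where "\<sigma> = (29 / 100) / u\<^sup>2"
  have \<sigma>: "0 \<le> \<sigma>" "\<sigma> \<le> 1" using u2 unfolding \<sigma>_def by (auto simp: divide_le_eq)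
  define \<tau> where "\<tau> i = (if a \<le> i then \<sigma> else 0)" for i
  have "notfound N \<epsilon> p T x Q f 0 {..<N} (queries N \<epsilon> 0) \<le> (\<Prod>i\<in>{0..<G}. 1 - \<tau> i)"
  proof (rule notfound_le_prod[OF T])
    fix i S assume i: "i < G" and S: "S \<subseteq> {..<N}" "x \<in> S" "N \<le> card S + i"
    define m where "m = card S"
    have m: "real N - real i \<le> real m" "m \<le> N" "2 \<le> m"
      using S card_mono[of "{..<N}" S] i GN N by (auto simp: m_def)
    define k where "k = kg N \<epsilon> i (queries N \<epsilon> i)"
    show "\<tau> i \<le> Re (round_state N p T x S (kg N \<epsilon> i (queries N \<epsilon> i)) x x)"
    proof (cases "a \<le> i")
      case True
      define v where "v = sqrt (1 + real i / (10 * L))"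
      have iv: "real i = 10 * L * (v\<^sup>2 - 1)" using L by (simp add: v_def)
      \<comment> \<open>This selects the quantum branch of \<open>kg\<close>.\<close>
      have "real (queries N \<epsilon> i) \<le> (1 - \<epsilon>) * real N"
        using queries_mono[of i G N \<epsilon>] i qA A by linarith
      moreover have "alpha \<epsilon> i = 1 / v" using L unfolding v_def L_def by (intro alpha_eq) simp
      ultimately have k: "k = nat \<lfloor>1 / v * (pi / 4) * sqrt (real N - real i)\<rfloor>"
        by (simp add: k_def kg_def)
      have "u / 2 \<le> v" unfolding v_def
      proof (rule real_le_rsqrt)
        have "10 * L * (u\<^sup>2 / 4 - 1) \<le> real i" using a(1) True by linarith
        then show "(u / 2)\<^sup>2 \<le> 1 + real i / (10 * L)" using L by (simp add: power_divide field_simps)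
      qed
      moreover have "v \<le> u" unfolding v_def using v_le i by simp
      ultimately have "\<sigma> \<le> (1 - p) ^ k * (sin ((2 * real k + 1) * arcsin (1 / sqrt m)))\<^sup>2"
        unfolding k \<sigma>_def
        using grover_round_bound[OF L T(2,3) D_def[unfolded s_def] LD[unfolded s_def] u_def _ _ iv m(1,2) refl] by blast
      also have "\<dots> \<le> Re (round_state N p T x S k x x)"
        using m(3) unfolding m_def by (intro round_state_success_sin T S)
      finally show ?thesis using True by (simp add: \<tau>_def k_def)
    next
      case False
      then show ?thesis using S by (auto simp: \<tau>_def intro!: round_state_nonneg T)
    qed
  qed (use \<sigma> qA Q f x in \<open>auto simp: \<tau>_def\<close>)
  also have "(\<Prod>i\<in>{0..<G}. 1 - \<tau> i) = (\<Prod>i\<in>{a..<G}. 1 - \<sigma>)"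
    by (intro prod.mono_neutral_cong_right) (auto simp: \<tau>_def)
  also have "\<dots> = (1 - \<sigma>) ^ (G - a)" by simp
  also have "\<dots> \<le> exp (- (\<sigma> * real (G - a)))" by (rule one_minus_power_le_exp[OF \<sigma>(2)])
  also have "\<dots> \<le> exp (- L)"
  proof -
    have "L = \<sigma> * (L / \<sigma>)" using u by (simp add: \<sigma>_def)
    also have "\<dots> \<le> \<sigma> * real (G - a)"
    proof (intro mult_left_mono \<sigma>(1))
      \<comment> \<open>About 3.45 L u^2 credited rounds are needed and at least 7.5 L u^2 - 2 are
        available; L u^2 >= 25/6 makes the surplus exceed the rounding loss 2.\<close>
      have "(2 / 3) * (25 / 4) \<le> L * u\<^sup>2" using L u2 by (intro mult_mono) auto
      moreover have "L / \<sigma> = (100 / 29) * (L * u\<^sup>2)" by (simp add: \<sigma>_def)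
      moreover have "real G - real a \<ge> 75 / 10 * (L * u\<^sup>2) - 2" using G(2) a(2) by (simp add: algebra_simps)
      ultimately show "L / \<sigma> \<le> real (G - a)" by linarith
    qed
    finally show ?thesis by simp
  qed
  also have "\<dots> = \<epsilon>" using \<epsilon> by (simp add: L_def ln_div)
  finally show ?thesis by simp
qed

theorem theorem4:
  fixes N :: nat and \<epsilon> p :: real and T :: "cmat \<Rightarrow> cmat"
  assumes "N \<ge> 100" and "0 < \<epsilon>" and "\<epsilon> \<le> 1/2"
    and "0 \<le> p" and "p \<le> 1"
    and "quantum_channel N T"
  defines "Q \<equiv> min (100 * (real N * p + sqrt (real N)) * ln (1 / \<epsilon>))
                    (2 * (1 - \<epsilon>) * real N + sqrt (real N))"
  shows "(1 / real N) * (\<Sum>x<N. notfound N \<epsilon> p T x Q (nat \<lfloor>Q\<rfloor> + 1) 0 {..<N} 0) \<le> \<epsilon>"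
proof -
  \<comment> \<open>With 49 instead of 50, the first budget is 2 A + 2 (A / 49) >= 2 A + sqrt N. So
    when A exceeds (1 - eps) N, the first budget exceeds the second and the minimum is the
    second.\<close>
  define A where "A = 49 * (real N * p + sqrt (real N)) * ln (1 / \<epsilon>)"
  have "ln 2 \<le> ln (1 / \<epsilon>)" using assms by (subst ln_le_cancel_iff) (auto simp: field_simps)
  then have L: "2 / 3 \<le> ln (1 / \<epsilon>)" using ln2_ge_two_thirds by linarith
  have f: "Q < real (nat \<lfloor>Q\<rfloor> + 1)" by linarith
  have "(real N * p + sqrt (real N)) * (2 / 3) \<le> (real N * p + sqrt (real N)) * ln (1 / \<epsilon>)"
    using L assms by (intro mult_left_mono) auto
  moreover have "0 \<le> real N * p" using assms by simp
  moreover have "A / 49 = (real N * p + sqrt (real N)) * ln (1 / \<epsilon>)" by (simp add: A_def)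
  moreover have "0 \<le> sqrt (real N)" by simp
  ultimately have A_ge: "sqrt (real N) / 2 \<le> A / 49" by argo
  have "100 * (real N * p + sqrt (real N)) * ln (1 / \<epsilon>) = 100 / 49 * A"
    unfolding A_def mult.assoc[of _ _ "ln (1 / \<epsilon>)"] by simp
  then have Q_eq: "Q = min (100 / 49 * A) (2 * (1 - \<epsilon>) * real N + sqrt (real N))"
    unfolding Q_def by (rule arg_cong)
  \<comment> \<open>The bound holds for each fixed marked element, and so for the average over
    x.\<close>
  have "notfound N \<epsilon> p T x Q (nat \<lfloor>Q\<rfloor> + 1) 0 {..<N} 0 \<le> \<epsilon>" if x: "x < N" for x
  proof (cases "A \<le> (1 - \<epsilon>) * real N")
    case True
    have "0 \<le> sqrt (real N)" by simp
    with A_ge True have "A \<le> Q" unfolding Q_eq mult.assoc min.bounded_iff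
      by (intro conjI) linarith+
    with True f show ?thesis
      unfolding A_def using assms(1-6) x by (intro notfound_le_quantum_budget) auto
  next
    case False
    then have "2 * (1 - \<epsilon>) * real N + sqrt (real N) \<le> Q" unfolding Q_eq mult.assoc min.bounded_iff
      using A_ge by (intro conjI) linarith+
    with f show ?thesis using assms(1-6) x by (intro notfound_le_classical_budget) auto
  qed
  then have "(\<Sum>x<N. notfound N \<epsilon> p T x Q (nat \<lfloor>Q\<rfloor> + 1) 0 {..<N} 0) \<le> (\<Sum>x<N. \<epsilon>)"
    by (intro sum_mono) simp
  with assms(1) show ?thesis by (simp add: field_simps)
qed

end
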